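(* M-CLP is feasible if and only if Test-LP is feasible.
   Context: Let $T>0$, $A$ a constant $K\times J$ matrix, $\beta,b\in\mathbb R^K$, $\gamma,c\in\mathbb R^J$ constant vectors. Superscript $T$ on vectors is transpose; vector inequalities are componentwise. M-CLP: maximize $\int_{0-}^T(\gamma+(T-t)c)^{T}dU(t)$ subject to $AU(t)\le\beta+bt$ for $0\le t\le T$, where $U:[0,T]\to\mathbb R^J$ is non-negative, non-decreasing and right-continuous (Lebesgue–Stieltjes integral, convention $U(0-)=0$). Test-LP is the finite-dimensional linear program in $\mathbf u,U\in\mathbb R^J$: $$\max\ (\gamma+cT)^{T}\mathbf u+\gamma^{T}U\quad\text{s.t. } A\mathbf u\le\beta,\quad A\mathbf u+AU\le\beta+bT,\quad \mathbf u,U\ge 0.$$ *)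

theory Defs
  imports "HOL-Analysis.Analysis"
begin

record 'x maximization =
  feasible_set :: "'x set"
  objective :: "'x \<Rightarrow> real"

definition feasible :: "'x maximization \<Rightarrow> bool" where
  "feasible P \<longleftrightarrow> feasible_set P \<noteq> {}"

text \<open>
  The distribution function on the whole line of the Stieltjes measure of a control given on
  \<open>[0,T]\<close>. It vanishes to the left of \<open>0\<close>, which is the convention \<open>U(0-) = 0\<close>: the measure
  has an atom of mass \<open>U(0)\<close> at \<open>0\<close>, and the integral over \<open>{0..T}\<close> counts it.
\<close>

definition extend_control :: "real \<Rightarrow> (real \<Rightarrow> real) \<Rightarrow> real \<Rightarrow> real" where
  "extend_control T u t = (if t < 0 then 0 else u (min t T))"

text \<open>
  Controls are total functions of which only the values on \<open>[0,T]\<close> matter. The order on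
  \<^typ>\<open>real ^ 'n\<close> is the componentwise one.
\<close>

definition M_CLP ::
  "real \<Rightarrow> real ^ 'j ^ 'k \<Rightarrow> real ^ 'k \<Rightarrow> real ^ 'k \<Rightarrow> real ^ 'j \<Rightarrow> real ^ 'j
    \<Rightarrow> (real \<Rightarrow> real ^ 'j) maximization" where
  "M_CLP T A \<beta> b \<gamma> c =
    \<lparr>feasible_set = {U.
        (\<forall>t\<in>{0..T}. 0 \<le> U t) \<and>
        mono_on {0..T} U \<and>
        (\<forall>t\<in>{0..<T}. continuous (at_right t) U) \<and>
        (\<forall>t\<in>{0..T}. A *v U t \<le> \<beta> + t *\<^sub>R b)},
     objective = (\<lambda>U. \<Sum>j\<in>UNIV.
        LINT t:{0..T}|interval_measure (extend_control T (\<lambda>s. U s $ j)).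
          (\<gamma> + (T - t) *\<^sub>R c) $ j)\<rparr>"

definition Test_LP ::
  "real \<Rightarrow> real ^ 'j ^ 'k \<Rightarrow> real ^ 'k \<Rightarrow> real ^ 'k \<Rightarrow> real ^ 'j \<Rightarrow> real ^ 'j
    \<Rightarrow> ((real ^ 'j) \<times> (real ^ 'j)) maximization" where
  "Test_LP T A \<beta> b \<gamma> c =
    \<lparr>feasible_set = {(u, U).
        A *v u \<le> \<beta> \<and>
        A *v u + A *v U \<le> \<beta> + T *\<^sub>R b \<and>
        0 \<le> u \<and> 0 \<le> U},
     objective = (\<lambda>(u, U). (\<gamma> + T *\<^sub>R c) \<bullet> u + \<gamma> \<bullet> U)\<rparr>"

end

theory Submission imports Defs begin

text \<open>
  The constraints at the two end points of \<open>[0,T]\<close> decide feasibility. A feasible control \<open>U\<close>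
  of the continuous problem gives the feasible point \<open>(U 0, U T - U 0)\<close> of the test problem.
  Conversely, a feasible point \<open>(u, V)\<close> gives the control \<open>t \<mapsto> u + (t / T) V\<close>, an initial
  impulse followed by a constant rate: both its image under \<open>A\<close> and the bound
  \<open>\<beta> + t b\<close> are affine in \<open>t\<close>, so the constraint at time \<open>t\<close> is a convex combination
  of the constraints at \<open>0\<close> and \<open>T\<close>, which are those of the test problem.
\<close>

lemma Test_LP_feasible_if_M_CLP_feasible:
  assumes "T \<ge> 0" and "U \<in> feasible_set (M_CLP T A \<beta> b \<gamma> c)"
  shows "(U 0, U T - U 0) \<in> feasible_set (Test_LP T A \<beta> b \<gamma> c)"
proof -
  have pos: "0 \<le> U 0" and le: "U 0 \<le> U T"
    and A0: "A *v U 0 \<le> \<beta>" and AT: "A *v U T \<le> \<beta> + T *\<^sub>R b"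
    using assms by (force simp: M_CLP_def mono_on_def dest: bspec[of _ _ 0])+
  show ?thesis
    using pos le A0 AT
    by (auto simp: Test_LP_def matrix_vector_mult_diff_distrib less_eq_vec_def)
qed

lemma M_CLP_feasible_if_Test_LP_feasible:
  assumes "T > 0" and "(u, V) \<in> feasible_set (Test_LP T A \<beta> b \<gamma> c)"
  shows "(\<lambda>t. u + (t / T) *\<^sub>R V) \<in> feasible_set (M_CLP T A \<beta> b \<gamma> c)"
proof -
  have u: "0 \<le> u" and V: "0 \<le> V" and A0: "A *v u \<le> \<beta>"
    and AT: "A *v u + A *v V \<le> \<beta> + T *\<^sub>R b"
    using assms(2) by (auto simp: Test_LP_def)
  have nonneg: "0 \<le> u + (t / T) *\<^sub>R V" if "t \<in> {0..T}" for t
    using u V that \<open>T > 0\<close> by (auto simp: less_eq_vec_def)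
  have mono: "mono_on {0..T} (\<lambda>t. u + (t / T) *\<^sub>R V)"
    using V \<open>T > 0\<close>
    by (auto simp: mono_on_def less_eq_vec_def intro!: mult_right_mono divide_right_mono)
  have cont: "continuous (at_right t) (\<lambda>t. u + (t / T) *\<^sub>R V)" for t
    using \<open>T > 0\<close> by (intro continuous_intros) auto
  have bound: "A *v (u + (t / T) *\<^sub>R V) \<le> \<beta> + t *\<^sub>R b" if t: "t \<in> {0..T}" for t
  proof -
    define s where "s = t / T"
    have s: "0 \<le> s" "s \<le> 1" and sT: "s * T = t"
      using t \<open>T > 0\<close> by (auto simp: s_def)
    \<comment> \<open>Weight \<open>1 - s\<close> on the constraint at \<open>0\<close>, weight \<open>s\<close> on the one at \<open>T\<close>.\<close>
    have "(A *v u) $ i + s * (A *v V) $ i \<le> \<beta> $ i + t * b $ i" for i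
    proof -
      have "(1 - s) * (A *v u) $ i \<le> (1 - s) * \<beta> $ i"
        using A0 s by (auto simp: less_eq_vec_def intro!: mult_left_mono)
      moreover have "s * ((A *v u) $ i + (A *v V) $ i) \<le> s * (\<beta> $ i + T * b $ i)"
        using AT s by (intro mult_left_mono) (auto simp: less_eq_vec_def)
      ultimately show ?thesis
        by (simp add: algebra_simps flip: sT)
    qed
    then show ?thesis
      by (simp add: less_eq_vec_def matrix_vector_right_distrib matrix_vector_mult_scaleR
          flip: s_def)
  qed
  show ?thesis
    using nonneg mono cont bound by (simp add: M_CLP_def)
qed

theorem theorem3p2:
  fixes T :: real
    and A :: "real ^ 'j ^ 'k"
    and \<beta> b :: "real ^ 'k"
    and \<gamma> c :: "real ^ 'j"
  assumes "T > 0"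
  shows "feasible (M_CLP T A \<beta> b \<gamma> c) \<longleftrightarrow> feasible (Test_LP T A \<beta> b \<gamma> c)"
  using Test_LP_feasible_if_M_CLP_feasible[of T] M_CLP_feasible_if_Test_LP_feasible[of T] assms
  unfolding feasible_def by (metis all_not_in_conv less_imp_le surj_pair)

end
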